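(* Let $\overline G=(V,E)$ be a graph, let $\Omega\subset V$ be finite and connected, let $g:\overline\Omega\setminus\Omega\to\mathbb R$ and $\vec E'\in\mathcal E'$. Let $v:\overline\Omega\to\mathbb R$ be a nonzero solution of $$d_x^{out}\,v(x)=\sum_{y:\,y\to x}v(y)\qquad\text{for all }x\in\overline\Omega$$ on the directed graph $\vec G_{\vec E'}$, normalized so that $v>0$ over $\Omega$. Then $$C(g,\Omega,\vec E')\ge\min\left\{0,\ -\frac{\sum_{y\in\overline\Omega\setminus\Omega}g(y)v(y)}{\sharp\Omega\,\min_{x\in\Omega}v(x)}\right\}>-\infty.$$ In particular, the infimum in the definition of $C(g,\Omega,\vec E')$ is achieved and is thus a minimum.
   Context: Edge weights are $1$, and $\sharp$ denotes cardinality. $\overline\Omega$ is $\Omega$ together with all vertices adjacent to a vertex of $\Omega$; $\overrightarrow{\partial\Omega}:=\{(x,y):\{x,y\}\in E,\ x\in\Omega,\ y\in\overline\Omega\setminus\Omega\}$. For $x\in\Omega$, $\Delta u(x):=\sum_{y:\{x,y\}\in E}(u(x)-u(y))$. $\mathcal E':=\{\vec E'\subset\overrightarrow{\partial\Omega}:\ \overline\Omega\setminus\Omega=\{y:(x,y)\in\vec E'\},\ \sharp\vec E'=\sharp(\overline\Omega\setminus\Omega)\}$. For $\vec E'\in\mathcal E'$, $$C(g,\Omega,\vec E'):=\inf\left\{\max_{x\in\Omega}\Delta u(x):\ u:\overline\Omega\to\mathbb R,\ \forall(x,y)\in\vec E',\ u(y)-u(x)=g(y)\right\},$$ and $\vec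 G_{\vec E'}$ is the directed graph with vertex set $\overline\Omega$ and directed edges $\{(x,y):x\in\Omega,\ y\in\overline\Omega,\ \{x,y\}\in E\}\cup\{(y,x):(x,y)\in\vec E'\}$. Write $x\to y$ if $(x,y)$ is a directed edge; $d_x^{out}$ is the number of directed edges starting at $x$. When $\Omega$ is connected a nonzero solution $v$ exists, is unique up to scalar multiples, and has constant sign on $\Omega$. *)

theory Defs
  imports "HOL-Analysis.Analysis" "Graph_Theory.Graph_Theory"
begin

text \<open>
  A (simple, undirected, possibly infinite) graph with unit edge weights is a
  \<^locale>\<open>pair_bidirected_digraph\<close>, i.e. a loop-free symmetric digraph whose arcs are pairs of
  vertices: the undirected edge between \<open>x\<close> and \<open>y\<close> is present iff \<open>(x, y) \<in> parcs G\<close>, equivalently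
  iff \<open>(y, x) \<in> parcs G\<close>. Functions on the closure of \<open>\<Omega>\<close> are represented by functions on the whole
  type; their values outside the closure are never inspected.
\<close>

definition vclosure :: "'a pair_pre_digraph \<Rightarrow> 'a set \<Rightarrow> 'a set" where
  "vclosure G \<Omega> = \<Omega> \<union> {y. \<exists>x\<in>\<Omega>. (x, y) \<in> parcs G}"

definition vboundary :: "'a pair_pre_digraph \<Rightarrow> 'a set \<Rightarrow> 'a set" where
  "vboundary G \<Omega> = vclosure G \<Omega> - \<Omega>"

definition dir_boundary :: "'a pair_pre_digraph \<Rightarrow> 'a set \<Rightarrow> ('a \<times> 'a) set" where
  "dir_boundary G \<Omega> = {(x, y). (x, y) \<in> parcs G \<and> x \<in> \<Omega> \<and> y \<in> vboundary G \<Omega>}"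

definition graph_laplacian :: "'a pair_pre_digraph \<Rightarrow> ('a \<Rightarrow> real) \<Rightarrow> 'a \<Rightarrow> real" where
  "graph_laplacian G u x = (\<Sum>y\<in>{y. (x, y) \<in> parcs G}. u x - u y)"

text \<open>
  The family of sets of boundary edges that contain exactly one edge for each boundary vertex.
\<close>

definition boundary_selections :: "'a pair_pre_digraph \<Rightarrow> 'a set \<Rightarrow> ('a \<times> 'a) set set" where
  "boundary_selections G \<Omega> =
     {E'. E' \<subseteq> dir_boundary G \<Omega> \<and> vboundary G \<Omega> = {y. \<exists>x. (x, y) \<in> E'}
        \<and> card E' = card (vboundary G \<Omega>)}"

definition neumann_admissible :: "('a \<times> 'a) set \<Rightarrow> ('a \<Rightarrow> real) \<Rightarrow> ('a \<Rightarrow> real) set" where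
  "neumann_admissible E' g = {u. \<forall>(x, y)\<in>E'. u y - u x = g y}"

text \<open>
  The infimum is taken in the extended reals, so that it is \<open>-\<infinity>\<close> (rather than an unspecified real)
  if the maxima are unbounded below.
\<close>

definition C_const :: "'a pair_pre_digraph \<Rightarrow> ('a \<Rightarrow> real) \<Rightarrow> 'a set \<Rightarrow> ('a \<times> 'a) set \<Rightarrow> ereal" where
  "C_const G g \<Omega> E' =
     (INF u\<in>neumann_admissible E' g. ereal (MAX x\<in>\<Omega>. graph_laplacian G u x))"

definition selection_digraph ::
    "'a pair_pre_digraph \<Rightarrow> 'a set \<Rightarrow> ('a \<times> 'a) set \<Rightarrow> 'a pair_pre_digraph" where
  "selection_digraph G \<Omega> E' =
     \<lparr> pverts = vclosure G \<Omega>,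
       parcs = {(x, y). x \<in> \<Omega> \<and> y \<in> vclosure G \<Omega> \<and> (x, y) \<in> parcs G} \<union> {(y, x). (x, y) \<in> E'} \<rparr>"

definition balanced_on :: "'a pair_pre_digraph \<Rightarrow> ('a \<Rightarrow> real) \<Rightarrow> bool" where
  "balanced_on D v \<longleftrightarrow>
     (\<forall>x\<in>pverts D. real (out_degree (with_proj D) x) * v x = (\<Sum>y\<in>{y. y \<rightarrow>\<^bsub>with_proj D\<^esub> x}. v y))"

end

theory Submission
  imports Defs
begin

text \<open>
  The constraint \<open>u y - u x = g y\<close> along the selected edge \<open>(x, y)\<close> says that the Laplacian of the
  selection digraph takes the value \<open>g y\<close> at the boundary vertex \<open>y\<close>, because the only arc leaving
  \<open>y\<close> is the reversed edge \<open>(y, x)\<close>; at vertices of \<open>\<Omega>\<close> this Laplacian is the graph Laplacian. So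
  admissible functions are the solutions of a Poisson equation on a digraph \<open>R\<close> whose right-hand
  side is prescribed on the boundary and free on \<open>\<Omega>\<close>.

  A balanced function \<open>v\<close> is a left null vector of the matrix of this Laplacian. Pairing with \<open>v\<close>
  therefore gives
  \<open>(\<Sum>x\<in>\<Omega>. v x * \<Delta>u x) = - (\<Sum>y\<in>\<partial>\<Omega>. g y * v y)\<close> for every admissible \<open>u\<close>
  (\<open>balanced_pairing\<close>), and since \<open>v > 0\<close> on \<open>\<Omega>\<close> the maximum of \<open>\<Delta>u\<close> is at least the weighted mean
  \<open>c = - (\<Sum>y\<in>\<partial>\<Omega>. g y * v y) / (\<Sum>x\<in>\<Omega>. v x)\<close>. The claimed bound is a weaker form of this,
  obtained from \<open>(\<Sum>x\<in>\<Omega>. v x) \<ge> card \<Omega> * (MIN x\<in>\<Omega>. v x)\<close> when \<open>c < 0\<close> and trivial otherwise.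

  The infimum is attained because some admissible \<open>u\<close> has \<open>\<Delta>u = c\<close> on all of \<open>\<Omega>\<close>. By the Fredholm
  alternative this Poisson equation is solvable iff its right-hand side is orthogonal to all
  balanced functions. On a strongly connected digraph these are the multiples of \<open>v\<close>
  (\<open>balanced_unique\<close>, a minimum principle), and \<open>c\<close> is precisely the constant that makes the
  right-hand side orthogonal to \<open>v\<close>.
\<close>

section \<open>The Fredholm alternative\<close>

text \<open>
  Gaussian elimination, one unknown at a time. Working with an index set inside an arbitrary type
  avoids encoding the number of vertices as a dimension.
\<close>

lemma fredholm_alternative:
  fixes A :: "'i \<Rightarrow> 'j \<Rightarrow> real" and b :: "'i \<Rightarrow> real"
  assumes "finite J" and "finite I"
  shows "(\<exists>u. \<forall>i\<in>I. (\<Sum>j\<in>J. A i j * u j) = b i)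
       \<or> (\<exists>w. (\<forall>j\<in>J. (\<Sum>i\<in>I. w i * A i j) = 0) \<and> (\<Sum>i\<in>I. w i * b i) \<noteq> 0)"
  using assms(1)
proof (induction J arbitrary: A b rule: finite_induct)
  case empty
  show ?case
  proof (cases "\<forall>i\<in>I. b i = 0")
    case False
    then obtain p where p: "p \<in> I" "b p \<noteq> 0" by blast
    have "(\<Sum>i\<in>I. (if i = p then 1 else 0) * b i) = b p"
      using p assms(2) by (simp add: if_distrib[of "\<lambda>x. x * _"] cong: if_cong)
    with p show ?thesis
      by (intro disjI2 exI[of _ "\<lambda>i. if i = p then 1 else 0"]) auto
  qed simp
next
  case (insert k J)
  show ?case
  proof (cases "\<exists>p\<in>I. A p k \<noteq> 0")
    case False
    have "(\<Sum>j\<in>insert k J. A i j * u j) = (\<Sum>j\<in>J. A i j * u j)" if "i \<in> I" for i u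
      using that False insert.hyps by simp
    moreover have "(\<Sum>i\<in>I. w i * A i k) = 0" for w
      using False by (intro sum.neutral) auto
    ultimately show ?thesis using insert.IH[of A b] by auto
  next
    case True
    then obtain p where p: "p \<in> I" "A p k \<noteq> 0" by blast
    define r where "r i = A i k / A p k" for i
    define A' where "A' i j = A i j - r i * A p j" for i j
    define b' where "b' i = b i - r i * b p" for i
    consider u where "\<forall>i\<in>I. (\<Sum>j\<in>J. A' i j * u j) = b' i"
      | w where "\<forall>j\<in>J. (\<Sum>i\<in>I. w i * A' i j) = 0" "(\<Sum>i\<in>I. w i * b' i) \<noteq> 0"
      using insert.IH[of A' b'] by blast
    then show ?thesis
    proof cases
      case 1
      \<comment> \<open>Back substitution: the pivot equation \<open>p\<close> determines the eliminated unknown.\<close>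
      define u' where "u' = u(k := (b p - (\<Sum>j\<in>J. A p j * u j)) / A p k)"
      have J: "(\<Sum>j\<in>J. A i j * u' j) = (\<Sum>j\<in>J. A i j * u j)" for i
        using insert.hyps by (intro sum.cong) (auto simp: u'_def)
      have "(\<Sum>j\<in>insert k J. A i j * u' j) = b i" if i: "i \<in> I" for i
      proof -
        have "(\<Sum>j\<in>J. A i j * u j) - r i * (\<Sum>j\<in>J. A p j * u j) = b i - r i * b p"
          using 1 i
          by (simp add: A'_def b'_def left_diff_distrib sum_subtractf sum_distrib_left mult.assoc)
        moreover have "A i k * u' k = r i * b p - r i * (\<Sum>j\<in>J. A p j * u j)"
          by (simp add: u'_def r_def right_diff_distrib diff_divide_distrib)
        ultimately show ?thesis using insert.hyps J by simp
      qed
      then show ?thesis by blast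
    next
      case 2
      \<comment> \<open>Undoing the row operations on the left charges every subtracted multiple of row \<open>p\<close> to \<open>w p\<close>.\<close>
      define w' where "w' i = w i - (if i = p then \<Sum>i\<in>I. w i * r i else 0)" for i
      have w': "(\<Sum>i\<in>I. w' i * f i) = (\<Sum>i\<in>I. w i * (f i - r i * f p))" for f :: "'i \<Rightarrow> real"
      proof -
        have "(\<Sum>i\<in>I. w' i * f i)
            = (\<Sum>i\<in>I. w i * f i) - (\<Sum>i\<in>I. if i = p then (\<Sum>i\<in>I. w i * r i) * f p else 0)"
          unfolding sum_subtractf[symmetric]
          by (intro sum.cong) (auto simp: w'_def left_diff_distrib)
        also have "\<dots> = (\<Sum>i\<in>I. w i * f i) - (\<Sum>i\<in>I. w i * r i) * f p"
          using p assms(2) by simp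
        also have "\<dots> = (\<Sum>i\<in>I. w i * (f i - r i * f p))"
          by (simp add: right_diff_distrib sum_subtractf sum_distrib_right mult.assoc)
        finally show ?thesis .
      qed
      have "(\<Sum>i\<in>I. w' i * A i k) = 0"
        using p by (simp add: w' r_def)
      moreover have "(\<Sum>i\<in>I. w' i * A i j) = 0" if "j \<in> J" for j
        using 2 that by (simp add: w' A'_def)
      moreover have "(\<Sum>i\<in>I. w' i * b i) \<noteq> 0"
        using 2 by (simp add: w' b'_def)
      ultimately show ?thesis by (intro disjI2 exI[of _ w']) auto
    qed
  qed
qed

section \<open>The Poisson equation on a finite digraph\<close>

definition rel_laplacian :: "('a \<times> 'a) set \<Rightarrow> ('a \<Rightarrow> real) \<Rightarrow> 'a \<Rightarrow> real" where
  "rel_laplacian R u a = (\<Sum>b\<in>R `` {a}. u a - u b)"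

definition rel_balanced :: "'a set \<Rightarrow> ('a \<times> 'a) set \<Rightarrow> ('a \<Rightarrow> real) \<Rightarrow> bool" where
  "rel_balanced K R v \<longleftrightarrow> (\<forall>a\<in>K. real (card (R `` {a})) * v a = (\<Sum>b\<in>R\<inverse> `` {a}. v b))"

definition laplace_matrix :: "('a \<times> 'a) set \<Rightarrow> 'a \<Rightarrow> 'a \<Rightarrow> real" where
  "laplace_matrix R a c =
     (if a = c then real (card (R `` {a})) else 0) - (if (a, c) \<in> R then 1 else 0)"

lemma laplace_matrix_row:
  assumes "finite K" and "R \<subseteq> K \<times> K" and "a \<in> K"
  shows "(\<Sum>c\<in>K. laplace_matrix R a c * u c) = rel_laplacian R u a"
proof -
  have R: "R `` {a} = {c \<in> K. (a, c) \<in> R}" using assms(2) by auto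
  have "(\<Sum>c\<in>K. laplace_matrix R a c * u c)
      = (\<Sum>c\<in>K. if a = c then real (card (R `` {a})) * u a else 0)
        - (\<Sum>c\<in>K. if (a, c) \<in> R then u c else 0)"
    unfolding sum_subtractf[symmetric]
    by (intro sum.cong) (auto simp: laplace_matrix_def left_diff_distrib)
  also have "\<dots> = real (card (R `` {a})) * u a - (\<Sum>c\<in>R `` {a}. u c)"
    using assms(1,3) by (simp add: R sum.If_cases Int_def)
  finally show ?thesis by (simp add: rel_laplacian_def sum_subtractf)
qed

lemma laplace_matrix_column:
  assumes "finite K" and "R \<subseteq> K \<times> K" and "c \<in> K"
  shows "(\<Sum>a\<in>K. w a * laplace_matrix R a c)
       = real (card (R `` {c})) * w c - (\<Sum>a\<in>R\<inverse> `` {c}. w a)"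
proof -
  have R: "R\<inverse> `` {c} = {a \<in> K. (a, c) \<in> R}" using assms(2) by auto
  have "(\<Sum>a\<in>K. w a * laplace_matrix R a c)
      = (\<Sum>a\<in>K. if a = c then real (card (R `` {c})) * w c else 0)
        - (\<Sum>a\<in>K. if (a, c) \<in> R then w a else 0)"
    unfolding sum_subtractf[symmetric]
    by (intro sum.cong) (auto simp: laplace_matrix_def right_diff_distrib)
  also have "\<dots> = real (card (R `` {c})) * w c - (\<Sum>a\<in>R\<inverse> `` {c}. w a)"
    using assms(1,3) by (simp add: R sum.If_cases Int_def)
  finally show ?thesis .
qed

text \<open>
  Balance says that the columns of the Laplace matrix are orthogonal to \<open>v\<close>; exchanging the order of
  summation moves the matrix from \<open>u\<close> to \<open>v\<close>.
\<close>

lemma balanced_pairing: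
  assumes "finite K" and "R \<subseteq> K \<times> K" and "rel_balanced K R v"
  shows "(\<Sum>a\<in>K. v a * rel_laplacian R u a) = 0"
proof -
  have "(\<Sum>a\<in>K. v a * rel_laplacian R u a)
      = (\<Sum>a\<in>K. \<Sum>c\<in>K. v a * laplace_matrix R a c * u c)"
    using assms(1,2)
    by (intro sum.cong) (auto simp: laplace_matrix_row[symmetric] sum_distrib_left mult.assoc)
  also have "\<dots> = (\<Sum>c\<in>K. (\<Sum>a\<in>K. v a * laplace_matrix R a c) * u c)"
    by (subst sum.swap) (simp add: sum_distrib_right)
  also have "\<dots> = 0"
    using assms by (intro sum.neutral) (auto simp: laplace_matrix_column rel_balanced_def)
  finally show ?thesis .
qed

text \<open>
  Minimum principle. Subtracting from \<open>w\<close> the largest multiple of \<open>v\<close> that keeps the difference \<open>z\<close>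
  nonnegative makes \<open>z\<close> vanish somewhere. Balance at a zero of \<open>z\<close> forces \<open>z\<close> to vanish at all
  vertices with an arc into it, and strong connectedness spreads the zero over \<open>K\<close>.
\<close>

lemma balanced_unique:
  assumes K: "finite K" "K \<noteq> {}" and R: "R \<subseteq> K \<times> K"
    and conn: "\<And>a b. a \<in> K \<Longrightarrow> b \<in> K \<Longrightarrow> (a, b) \<in> R\<^sup>*"
    and v: "rel_balanced K R v" "\<And>a. a \<in> K \<Longrightarrow> v a > 0"
    and w: "rel_balanced K R w"
  obtains t where "\<And>a. a \<in> K \<Longrightarrow> w a = t * v a"
proof -
  define t where "t = (MIN a\<in>K. w a / v a)"
  have "t \<in> (\<lambda>a. w a / v a) ` K" unfolding t_def using K by (intro Min_in) auto
  then obtain m where m: "m \<in> K" "t = w m / v m" by auto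
  define z where "z a = w a - t * v a" for a
  have pos: "z a \<ge> 0" if "a \<in> K" for a
  proof -
    have "t \<le> w a / v a" unfolding t_def using K that by (intro Min_le) auto
    then show ?thesis using v(2)[OF that] by (simp add: z_def pos_le_divide_eq)
  qed
  have zm: "z m = 0" using m v(2)[of m] by (simp add: z_def)
  have bal: "real (card (R `` {a})) * z a = (\<Sum>b\<in>R\<inverse> `` {a}. z b)" if "a \<in> K" for a
    using v(1) w that
    by (simp add: rel_balanced_def z_def right_diff_distrib sum_subtractf
        sum_distrib_left[symmetric] mult.left_commute)
  have step: "z b = 0" if "(b, a) \<in> R" "z a = 0" for a b
  proof -
    have a: "a \<in> K" using that(1) R by blast
    have sub: "R\<inverse> `` {a} \<subseteq> K" using R by blast
    have "finite (R\<inverse> `` {a})" using sub K(1) by (rule finite_subset)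
    moreover have "\<forall>b\<in>R\<inverse> `` {a}. z b \<ge> 0" using sub pos by blast
    moreover have "(\<Sum>b\<in>R\<inverse> `` {a}. z b) = 0" using bal[OF a] that(2) by simp
    ultimately have "\<forall>b\<in>R\<inverse> `` {a}. z b = 0"
      using sum_nonneg_eq_0_iff[of "R\<inverse> `` {a}" z] by blast
    then show ?thesis using that(1) by blast
  qed
  have "z a = 0" if "a \<in> K" for a
    using conn[OF that m(1)]
    by (induction rule: converse_rtrancl_induct) (use zm step in blast)+
  then show thesis by (intro that[of t]) (simp add: z_def)
qed

text \<open>
  An obstruction provided by the Fredholm alternative is a balanced function, hence a multiple of
  \<open>v\<close>, and the orthogonality assumption excludes it.
\<close>

lemma poisson_solvable:
  assumes K: "finite K" "K \<noteq> {}" and R: "R \<subseteq> K \<times> K"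
    and conn: "\<And>a b. a \<in> K \<Longrightarrow> b \<in> K \<Longrightarrow> (a, b) \<in> R\<^sup>*"
    and v: "rel_balanced K R v" "\<And>a. a \<in> K \<Longrightarrow> v a > 0"
    and orth: "(\<Sum>a\<in>K. v a * f a) = 0"
  obtains u where "\<And>a. a \<in> K \<Longrightarrow> rel_laplacian R u a = f a"
proof -
  consider u where "\<forall>a\<in>K. (\<Sum>c\<in>K. laplace_matrix R a c * u c) = f a"
    | w where "\<forall>c\<in>K. (\<Sum>a\<in>K. w a * laplace_matrix R a c) = 0" "(\<Sum>a\<in>K. w a * f a) \<noteq> 0"
    using fredholm_alternative[OF K(1) K(1), of "laplace_matrix R" f] by blast
  then show thesis
  proof cases
    case 1
    then show thesis using K R by (intro that[of u]) (simp add: laplace_matrix_row)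
  next
    case 2
    then have "rel_balanced K R w"
      using K R by (simp add: laplace_matrix_column rel_balanced_def)
    then obtain t where "\<And>a. a \<in> K \<Longrightarrow> w a = t * v a"
      using balanced_unique[OF K R conn v] by blast
    then have "(\<Sum>a\<in>K. w a * f a) = t * (\<Sum>a\<in>K. v a * f a)"
      by (simp add: sum_distrib_left mult.assoc)
    with 2 orth show thesis by simp
  qed
qed

section \<open>The selection digraph\<close>

lemma balanced_on_iff_rel_balanced:
  "balanced_on D v \<longleftrightarrow> rel_balanced (pverts D) (parcs D) v"
proof -
  have "out_degree (with_proj D) x = card (parcs D `` {x})" for x
  proof -
    have "out_arcs (with_proj D) x = Pair x ` (parcs D `` {x})" by auto
    then show ?thesis by (simp add: out_degree_def card_image inj_on_def)
  qed
  moreover have "{y. y \<rightarrow>\<^bsub>with_proj D\<^esub> x} = (parcs D)\<inverse> `` {x}" for x by auto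
  ultimately show ?thesis by (simp add: balanced_on_def rel_balanced_def)
qed

lemma connected_induced_path:
  assumes "Digraph_Component.connected (with_proj G \<restriction> \<Omega>)" and "sym (parcs G)"
    and "x \<in> \<Omega>" and "y \<in> \<Omega>"
  shows "(x, y) \<in> (parcs G \<inter> \<Omega> \<times> \<Omega>)\<^sup>*"
proof -
  have "x \<rightarrow>\<^sup>*\<^bsub>with_proj (mk_symmetric (with_proj G \<restriction> \<Omega>))\<^esub> y"
    using assms by (simp add: Digraph_Component.connected_def strongly_connected_def)
  then have "(x, y) \<in> (parcs (mk_symmetric (with_proj G \<restriction> \<Omega>)))\<^sup>*"
    using reachable_rtranclI by fastforce
  moreover have "parcs (mk_symmetric (with_proj G \<restriction> \<Omega>)) \<subseteq> parcs G \<inter> \<Omega> \<times> \<Omega>"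
    using assms(2) by (auto simp: parcs_mk_symmetric induce_subgraph_def dest: symD)
  ultimately show ?thesis using rtrancl_mono by blast
qed

text \<open>
  A selection contains as many edges as there are boundary vertices and covers all of them, so the
  covering map is injective.
\<close>

lemma boundary_selection_unique:
  assumes "finite (vclosure G \<Omega>)" and "E' \<in> boundary_selections G \<Omega>"
    and "(x, y) \<in> E'" and "(x', y) \<in> E'"
  shows "x = x'"
proof -
  have E': "E' \<subseteq> vclosure G \<Omega> \<times> vclosure G \<Omega>" "snd ` E' = vboundary G \<Omega>"
      "card E' = card (vboundary G \<Omega>)"
    using assms(2) by (force simp: boundary_selections_def dir_boundary_def vboundary_def
        vclosure_def)+
  have "finite E'" using E'(1) assms(1) by (meson finite_SigmaI finite_subset)
  then have "inj_on snd E'" using E' by (intro eq_card_imp_inj_on) auto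
  then show ?thesis using inj_onD[of snd E' "(x, y)" "(x', y)"] assms(3,4) by simp
qed

theorem corollary6p1:
  fixes G :: "'a pair_pre_digraph"
    and \<Omega> :: "'a set"
    and g v :: "'a \<Rightarrow> real"
    and E' :: "('a \<times> 'a) set"
  assumes "pair_bidirected_digraph G"
    and "\<And>x. x \<in> \<Omega> \<Longrightarrow> finite {y. (x, y) \<in> parcs G}"
    and "\<Omega> \<subseteq> pverts G"
    and "finite \<Omega>"
    and "Digraph_Component.connected (with_proj G \<restriction> \<Omega>)"
    and "E' \<in> boundary_selections G \<Omega>"
    and "balanced_on (selection_digraph G \<Omega> E') v"
    and "\<exists>x\<in>vclosure G \<Omega>. v x \<noteq> 0"
    and "\<forall>x\<in>\<Omega>. v x > 0"
  shows "C_const G g \<Omega> E' \<ge>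
           ereal (min 0 (- ((\<Sum>y\<in>vboundary G \<Omega>. g y * v y) / (real (card \<Omega>) * (MIN x\<in>\<Omega>. v x)))))
       \<and> ereal (min 0 (- ((\<Sum>y\<in>vboundary G \<Omega>. g y * v y) / (real (card \<Omega>) * (MIN x\<in>\<Omega>. v x))))) > -\<infinity>
       \<and> (\<exists>u\<in>neumann_admissible E' g.
            ereal (MAX x\<in>\<Omega>. graph_laplacian G u x) = C_const G g \<Omega> E')"
proof -
  define K where "K = vclosure G \<Omega>"
  define B where "B = vboundary G \<Omega>"
  define R where "R = parcs (selection_digraph G \<Omega> E')"
  define S where "S = (\<Sum>y\<in>B. g y * v y)"
  define m where "m = (MIN x\<in>\<Omega>. v x)"
  define T where "T = (\<Sum>x\<in>\<Omega>. v x)"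
  define M where "M u = (MAX x\<in>\<Omega>. graph_laplacian G u x)" for u
  interpret pair_bidirected_digraph G by fact
  have sym: "sym (parcs G)" using pair_sym_arcs by (simp add: symmetric_def)
  have fin\<Omega>: "finite \<Omega>" by fact
  have ne\<Omega>: "\<Omega> \<noteq> {}"
    using assms(5) by (auto simp: Digraph_Component.connected_def strongly_connected_def)
  have finK: "finite K"
  proof -
    have "K = \<Omega> \<union> (\<Union>x\<in>\<Omega>. {y. (x, y) \<in> parcs G})" by (auto simp: K_def vclosure_def)
    then show ?thesis using fin\<Omega> assms(2) by auto
  qed
  have KB: "K = \<Omega> \<union> B" "\<Omega> \<inter> B = {}" by (auto simp: K_def B_def vboundary_def vclosure_def)
  have finB: "finite B" using finK KB by simp
  have neK: "K \<noteq> {}" using KB ne\<Omega> by simp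
  have E'_arc: "(x, y) \<in> parcs G" "x \<in> \<Omega>" "y \<in> B" if "(x, y) \<in> E'" for x y
    using that assms(6) by (auto simp: boundary_selections_def dir_boundary_def B_def)
  have E'_ex: "\<exists>x. (x, y) \<in> E'" if "y \<in> B" for y
    using that assms(6) by (auto simp: boundary_selections_def B_def)
  have R_iff: "(a, b) \<in> R \<longleftrightarrow> a \<in> \<Omega> \<and> (a, b) \<in> parcs G \<or> (b, a) \<in> E'" for a b
    by (auto simp: R_def selection_digraph_def vclosure_def)
  have RK: "R \<subseteq> K \<times> K"
    using E'_arc KB by (force simp: R_def selection_digraph_def K_def)
  have bal: "rel_balanced K R v"
    using assms(7) by (simp add: balanced_on_iff_rel_balanced K_def R_def selection_digraph_def)

  have out_\<Omega>: "R `` {x} = {y. (x, y) \<in> parcs G}" if "x \<in> \<Omega>" for x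
    using that E'_arc KB(2) by (auto simp: R_iff)
  have out_B: "R `` {y} = {x}" if "(x, y) \<in> E'" for x y
  proof -
    have "y \<notin> \<Omega>" using E'_arc(3)[OF that] KB(2) by blast
    moreover have "x' = x" if "(x', y) \<in> E'" for x'
      using boundary_selection_unique[OF finK[unfolded K_def] assms(6)] that \<open>(x, y) \<in> E'\<close> by blast
    ultimately show ?thesis using that R_iff by blast
  qed
  have lap_\<Omega>: "rel_laplacian R u x = graph_laplacian G u x" if "x \<in> \<Omega>" for u x
    using that by (simp add: rel_laplacian_def graph_laplacian_def out_\<Omega>)
  have lap_B: "rel_laplacian R u y = u y - u x" if "(x, y) \<in> E'" for u x y
    using that by (simp add: rel_laplacian_def out_B)
  have admissible: "u \<in> neumann_admissible E' g \<longleftrightarrow> (\<forall>y\<in>B. rel_laplacian R u y = g y)" for u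
  proof -
    have "u \<in> neumann_admissible E' g \<longleftrightarrow> (\<forall>(x, y)\<in>E'. rel_laplacian R u y = g y)"
      by (auto simp: neumann_admissible_def lap_B)
    also have "\<dots> \<longleftrightarrow> (\<forall>y\<in>B. rel_laplacian R u y = g y)"
      using E'_ex E'_arc(3) by blast
    finally show ?thesis .
  qed

  \<comment> \<open>At a boundary vertex balance expresses \<open>v\<close> as a nonempty sum of values of \<open>v\<close> on \<open>\<Omega>\<close>.\<close>
  have v_pos: "v a > 0" if "a \<in> K" for a
  proof (cases "a \<in> \<Omega>")
    case False
    then have "a \<in> B" using that KB by auto
    then obtain x where x: "(x, a) \<in> E'" using E'_ex by blast
    have sub: "R\<inverse> `` {a} \<subseteq> \<Omega>"
      using E'_arc(2) False R_iff by blast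
    have "x \<in> R\<inverse> `` {a}" using E'_arc[OF x] R_iff by blast
    moreover have "finite (R\<inverse> `` {a})" using sub fin\<Omega> by (rule finite_subset)
    moreover have "v b > 0" if "b \<in> R\<inverse> `` {a}" for b
      using that sub assms(9) by blast
    ultimately have "(\<Sum>b\<in>R\<inverse> `` {a}. v b) > 0" using sum_pos by blast
    moreover have "real (card (R `` {a})) * v a = (\<Sum>b\<in>R\<inverse> `` {a}. v b)"
      using bal that unfolding rel_balanced_def by blast
    ultimately show ?thesis unfolding out_B[OF x] by simp
  qed (use assms(9) in auto)

  \<comment> \<open>Every boundary vertex is joined by arcs in both directions to a vertex of the connected set \<open>\<Omega>\<close>.\<close>
  have conn: "(a, b) \<in> R\<^sup>*" if aK: "a \<in> K" and bK: "b \<in> K" for a b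
  proof -
    have "\<exists>x\<in>\<Omega>. (a, x) \<in> R\<^sup>*"
    proof (cases "a \<in> \<Omega>")
      case False
      then obtain x where "(x, a) \<in> E'" using aK KB(1) E'_ex by blast
      then have "x \<in> \<Omega>" "(a, x) \<in> R" using E'_arc R_iff by blast+
      then show ?thesis by blast
    qed auto
    then obtain x where x: "x \<in> \<Omega>" "(a, x) \<in> R\<^sup>*" by blast
    have "\<exists>y\<in>\<Omega>. (y, b) \<in> R\<^sup>*"
    proof (cases "b \<in> \<Omega>")
      case False
      then obtain y where "(y, b) \<in> E'" using bK KB(1) E'_ex by blast
      then have "y \<in> \<Omega>" "(y, b) \<in> R" using E'_arc R_iff by blast+
      then show ?thesis by blast
    qed auto
    then obtain y where y: "y \<in> \<Omega>" "(y, b) \<in> R\<^sup>*" by blast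
    have "parcs G \<inter> \<Omega> \<times> \<Omega> \<subseteq> R" using R_iff by blast
    then have "(x, y) \<in> R\<^sup>*"
      using connected_induced_path[OF assms(5) sym x(1) y(1)] rtrancl_mono by blast
    with x y show ?thesis by (meson rtrancl_trans)
  qed

  have T_pos: "T > 0" unfolding T_def using fin\<Omega> ne\<Omega> assms(9) by (intro sum_pos) auto
  have m_in: "m \<in> v ` \<Omega>" unfolding m_def using fin\<Omega> ne\<Omega> by (intro Min_in) auto
  then have m_pos: "m > 0" using assms(9) by auto
  have mT: "real (card \<Omega>) * m \<le> T"
    unfolding T_def m_def using fin\<Omega> by (intro sum_bounded_below) auto
  have split: "(\<Sum>a\<in>K. f a) = (\<Sum>x\<in>\<Omega>. f x) + (\<Sum>y\<in>B. f y)" for f :: "'a \<Rightarrow> real"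
    using KB fin\<Omega> finB by (simp add: sum.union_disjoint)

  have mean: "- S / T \<le> M u" if "u \<in> neumann_admissible E' g" for u
  proof -
    have "0 = (\<Sum>x\<in>\<Omega>. v x * graph_laplacian G u x) + S"
      using balanced_pairing[OF finK RK bal, of u] that
      by (simp add: split lap_\<Omega> admissible S_def mult.commute)
    moreover have "(\<Sum>x\<in>\<Omega>. v x * graph_laplacian G u x) \<le> (\<Sum>x\<in>\<Omega>. v x * M u)"
      using fin\<Omega> assms(9) by (intro sum_mono mult_left_mono) (auto simp: M_def less_imp_le)
    moreover have "(\<Sum>x\<in>\<Omega>. v x * M u) = M u * T"
      by (simp add: T_def sum_distrib_left mult.commute)
    ultimately have "- S \<le> M u * T" by linarith
    then show ?thesis using pos_divide_le_eq[OF T_pos] by blast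
  qed

  define f where "f a = (if a \<in> \<Omega> then - S / T else g a)" for a
  have "(\<Sum>a\<in>K. v a * f a) = 0"
  proof -
    have "(\<Sum>x\<in>\<Omega>. v x * f x) = T * (- S / T)" 
      unfolding T_def sum_distrib_right by (intro sum.cong) (auto simp: f_def T_def)
    moreover have "(\<Sum>y\<in>B. v y * f y) = S"
      unfolding S_def using KB(2) by (intro sum.cong) (auto simp: f_def)
    ultimately show ?thesis using T_pos by (simp add: split)
  qed
  then obtain u where u: "\<And>a. a \<in> K \<Longrightarrow> rel_laplacian R u a = f a"
    using poisson_solvable[OF finK neK RK conn bal v_pos] by blast
  have u_adm: "u \<in> neumann_admissible E' g" using u KB by (auto simp: admissible f_def)
  have "graph_laplacian G u x = - S / T" if "x \<in> \<Omega>" for x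
    using u[of x] that KB by (simp add: lap_\<Omega> f_def)
  then have "graph_laplacian G u ` \<Omega> = {- S / T}" using ne\<Omega> by force
  then have Mu: "M u = - S / T" by (simp add: M_def)

  have C: "C_const G g \<Omega> E' = ereal (- S / T)"
    unfolding C_const_def M_def[symmetric]
  proof (rule antisym)
    show "(INF u\<in>neumann_admissible E' g. ereal (M u)) \<le> ereal (- S / T)"
      using u_adm Mu by (intro INF_lower2[of u]) auto
    show "ereal (- S / T) \<le> (INF u\<in>neumann_admissible E' g. ereal (M u))"
      using mean by (intro INF_greatest) simp
  qed

  \<comment> \<open>The sign of \<open>S\<close> decides which of the two terms of the minimum bounds the mean.\<close>
  have "min 0 (- (S / (real (card \<Omega>) * m))) \<le> - S / T"
  proof (cases "S \<le> 0")
    case True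
    then have "0 \<le> - S / T" using T_pos by (intro divide_nonneg_pos) auto
    then show ?thesis by linarith
  next
    case False
    have "0 < real (card \<Omega>) * m" using m_pos fin\<Omega> ne\<Omega> by (simp add: card_gt_0_iff)
    then have "S / T \<le> S / (real (card \<Omega>) * m)" using False mT by (intro divide_left_mono) auto
    then show ?thesis by simp
  qed
  then have "ereal (min 0 (- (S / (real (card \<Omega>) * m)))) \<le> C_const G g \<Omega> E'"
    unfolding C ereal_less_eq(3) .
  moreover have "ereal (min 0 (- (S / (real (card \<Omega>) * m)))) > -\<infinity>"
    using less_ereal.simps(5) by blast
  moreover have "\<exists>u\<in>neumann_admissible E' g. ereal (M u) = C_const G g \<Omega> E'"
    unfolding C using u_adm Mu by blast
  ultimately show ?thesis unfolding S_def m_def B_def M_def by blast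
qed

end
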